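(* Let $n\ge2$ and $\sigma,\tau>0$, and consider the global game with noisy information sharing with $n$ agents and noise parameters $\sigma^2,\tau^2$. Let $h:\mathbb{R}^n\to\mathbb{R}$ be continuous, strictly decreasing in each of its $n$ arguments (the others being fixed), symmetric, and a fixed point threshold function (both notions defined in the context). Then $h$ leads to a threshold policy equilibrium, i.e. the strategy profile $(1_{h(y_1)\ge0},\dots,1_{h(y_n)\ge0})$ is a Bayesian Nash equilibrium.
   Context: Global game with noisy information sharing. There are $n$ agents $[n]=\{1,\dots,n\}$, each with action set $\{0,1\}$ ($1$ = risky, $0$ = safe). Under action profile $\alpha\in\{0,1\}^n$ the utility of agent $i$ is $u_i(\alpha)=\alpha_i\big(\sum_{j=1}^n\alpha_j-\theta\big)$. The fundamental $\theta$ is uniformly distributed over $\mathbb{R}$ (improper flat prior). Let $x_i=\theta+\xi_i$ for $i\in[n]$ and $y_{ji}=x_j+\zeta_{ji}$ for $j\ne i$, where $\xi_1,\dots,\xi_n$ are i.i.d. $\mathcal N(0,\sigma^2)$ and the $\zeta_{ji}$ are i.i.d. $\mathcal N(0,\tau^2)$, independent of the $\xi$'s (all noises independent of $\theta$). Agent $i$ observes $y_i=(x_i,\{y_{ji}\}_{j\in[n]\setminus\{i\}})\in\mathbb{R}^n$ (families indexed by agents are listed in increasing order of the index). Put $z_i=\sum_{j\in[n]\setminus\{i\}}y_{ji}$. Because the prior is improper, conditional laws, probabilities and expectations given $y_i=u$ are formal posteriors: one takes the $\sigma$-finite measure under which $\theta$ has Lebesgue measure and the noises have the stated laws, and conditions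 on $y_i=u$ by normalizing the joint density (this gives proper Gaussian laws). A strategy of agent $i$ is a measurable $s_i:\mathbb{R}^n\to\{0,1\}$, applied to $y_i$. A strategy $\tilde s$ is a best response of agent $i$ to $(s_j)_{j\ne i}$ if for every $u\in\mathbb{R}^n$: $\tilde s(u)=0$ whenever $1+E[\sum_{j\ne i}s_j(y_j)\mid y_i=u]<E[\theta\mid y_i=u]$, and $\tilde s(u)=1$ whenever $1+E[\sum_{j\ne i}s_j(y_j)\mid y_i=u]>E[\theta\mid y_i=u]$. A profile is a Bayesian Nash equilibrium if each $s_i$ is a best response to the others. Let $\frac1{\eta_n^2}=\frac1{\sigma^2}+\frac{n-1}{\sigma^2+\tau^2}$, $a_n=\eta_n^2/\sigma^2$, $b_n=\eta_n^2/(\sigma^2+\tau^2)$ (so that $E[\theta\mid y_i]=a_nx_i+b_nz_i$). Fixed point threshold function: $h:\mathbb{R}^n\to\mathbb{R}$ is a fixed point threshold function if for every $i\in[n]$ and every value of $y_i=(x_i,\{y_{ji}\}_{j\in[n]\setminus\{i\}})\in\mathbb{R}^n$, one has $h(y_i)=0$ if and only if $$a_nx_i+b_nz_i=1+\sum_{k\in[n]\setminus\{i\}}P\big(h(y_k)\ge0\mid y_i\big).$$ Symmetric: $h$ is symmetric if for every root $(x_i,\{y_{ji}\}_{j\in[n]\setminus\{i\}})$ of $h$, every vector obtained from it by permuting the entries $\{y_{ji}\}_{j\in[n]\setminus\{i\}}$ is also a root of $h$. *)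

theory Defs
  imports "HOL-Probability.Probability"
begin

text \<open>Agents are the elements of \<open>{1..n}\<close>.  The space \<open>\<real>^n\<close> is the set of extensional functions on
  \<open>{1..n}\<close>; the topology of the function type restricts on it to the Euclidean topology.\<close>

abbreviation Rn :: "nat \<Rightarrow> (nat \<Rightarrow> real) set" where
  "Rn n \<equiv> {1..n} \<rightarrow>\<^sub>E UNIV"

abbreviation borel_Rn :: "nat \<Rightarrow> (nat \<Rightarrow> real) measure" where
  "borel_Rn n \<equiv> Pi\<^sub>M {1..n} (\<lambda>_. borel)"

text \<open>\<open>Theta\<close> stands for the fundamental, \<open>Sig i\<close> for \<open>x\<^sub>i\<close>, and \<open>Msg j i\<close> for \<open>y\<^sub>j\<^sub>i\<close>, the noisy copy
  of \<open>x\<^sub>j\<close> received by \<open>i\<close>.  A configuration assigns a real to each variable in \<open>vars n\<close>.\<close>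

datatype var = Theta | Sig nat | Msg nat nat

definition vars :: "nat \<Rightarrow> var set" where
  "vars n = insert Theta (Sig ` {1..n} \<union> {Msg j i |j i. j \<in> {1..n} \<and> i \<in> {1..n} \<and> j \<noteq> i})"

definition observed :: "nat \<Rightarrow> nat \<Rightarrow> var set" where
  "observed n i = insert (Sig i) {Msg j i |j. j \<in> {1..n} - {i}}"

text \<open>In the observation vector \<open>y\<^sub>i\<close>, coordinate 1 is \<open>x\<^sub>i\<close> and the coordinates \<open>2, \<dots>, n\<close> are the
  \<open>y\<^sub>j\<^sub>i\<close> for \<open>j \<noteq> i\<close> in increasing order of \<open>j\<close>.  Thus coordinate \<open>p \<ge> 2\<close> comes from agent
  \<open>sender i p\<close>, and \<open>slot i\<close> is the inverse of \<open>sender i\<close>.\<close>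

definition sender :: "nat \<Rightarrow> nat \<Rightarrow> nat" where
  "sender i p = (if p \<le> i then p - 1 else p)"

definition slot :: "nat \<Rightarrow> nat \<Rightarrow> nat" where
  "slot i j = (if j < i then j + 1 else j)"

definition obs :: "nat \<Rightarrow> nat \<Rightarrow> (var \<Rightarrow> real) \<Rightarrow> nat \<Rightarrow> real" where
  "obs n i w = (\<lambda>p\<in>{1..n}. if p = 1 then w (Sig i) else w (Msg (sender i p) i))"

lemma bij_betw_sender:
  assumes "i \<in> {1..n}"
  shows "bij_betw (sender i) {2..n} ({1..n} - {i})"
  by (rule bij_betw_byWitness[where f' = "slot i"])
    (use assms in \<open>auto simp: sender_def slot_def\<close>)

lemma strict_mono_on_sender: "strict_mono_on {2..n} (sender i)"
  by (auto simp: strict_mono_on_def sender_def)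

text \<open>Density of all the variables, with respect to Lebesgue measure on the configurations, when
  \<open>\<theta>\<close> has Lebesgue measure: the noises are \<open>\<xi>\<^sub>i = x\<^sub>i - \<theta>\<close> and \<open>\<zeta>\<^sub>j\<^sub>i = y\<^sub>j\<^sub>i - x\<^sub>j\<close>, and the linear map
  from \<open>(\<theta>, \<xi>, \<zeta>)\<close> to \<open>(\<theta>, x, y)\<close> has determinant 1.\<close>

definition joint_density :: "nat \<Rightarrow> real \<Rightarrow> real \<Rightarrow> (var \<Rightarrow> real) \<Rightarrow> real" where
  "joint_density n \<sigma> \<tau> w =
     (\<Prod>i\<in>{1..n}. normal_density 0 \<sigma> (w (Sig i) - w Theta)) *
     (\<Prod>i\<in>{1..n}. \<Prod>j\<in>{1..n} - {i}. normal_density 0 \<tau> (w (Msg j i) - w (Sig j)))"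

text \<open>The configuration with \<open>y\<^sub>i = u\<close> whose variables not observed by \<open>i\<close> are given by \<open>w\<close>.\<close>

definition complete_config :: "nat \<Rightarrow> nat \<Rightarrow> (nat \<Rightarrow> real) \<Rightarrow> (var \<Rightarrow> real) \<Rightarrow> var \<Rightarrow> real" where
  "complete_config n i u w = (\<lambda>v\<in>vars n. if v \<in> observed n i
     then (case v of Sig _ \<Rightarrow> u 1 | Msg j _ \<Rightarrow> u (slot i j))
     else w v)"

lemma obs_complete_config:
  assumes "i \<in> {1..n}" "u \<in> Rn n"
  shows "obs n i (complete_config n i u w) = u"
proof
  fix p
  show "obs n i (complete_config n i u w) p = u p"
    using assms
    by (auto simp: obs_def complete_config_def vars_def observed_def sender_def slot_def
        PiE_def extensional_def)
qed

text \<open>The law of the whole configuration given \<open>y\<^sub>i = u\<close>.\<close>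

definition posterior ::
    "nat \<Rightarrow> real \<Rightarrow> real \<Rightarrow> nat \<Rightarrow> (nat \<Rightarrow> real) \<Rightarrow> (var \<Rightarrow> real) measure" where
  "posterior n \<sigma> \<tau> i u =
     (let L = Pi\<^sub>M (vars n - observed n i) (\<lambda>_. lborel);
          g = (\<lambda>w. ennreal (joint_density n \<sigma> \<tau> (complete_config n i u w)))
      in distr (density L (\<lambda>w. g w / (\<integral>\<^sup>+ w'. g w' \<partial>L)))
           (Pi\<^sub>M (vars n) (\<lambda>_. borel)) (complete_config n i u))"

definition is_strategy :: "nat \<Rightarrow> ((nat \<Rightarrow> real) \<Rightarrow> real) \<Rightarrow> bool" where
  "is_strategy n s \<longleftrightarrow> s \<in> borel_measurable (borel_Rn n) \<and> (\<forall>u\<in>Rn n. s u \<in> {0, 1})"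

definition best_response ::
    "nat \<Rightarrow> real \<Rightarrow> real \<Rightarrow> nat \<Rightarrow> ((nat \<Rightarrow> real) \<Rightarrow> real) \<Rightarrow> (nat \<Rightarrow> (nat \<Rightarrow> real) \<Rightarrow> real) \<Rightarrow> bool" where
  "best_response n \<sigma> \<tau> i t s \<longleftrightarrow> is_strategy n t \<and>
     (\<forall>u\<in>Rn n.
        let others = (\<integral>w. (\<Sum>j\<in>{1..n} - {i}. s j (obs n j w)) \<partial>posterior n \<sigma> \<tau> i u);
            fund = (\<integral>w. w Theta \<partial>posterior n \<sigma> \<tau> i u)
        in (1 + others < fund \<longrightarrow> t u = 0) \<and> (1 + others > fund \<longrightarrow> t u = 1))"

definition bayes_nash_equilibrium ::
    "nat \<Rightarrow> real \<Rightarrow> real \<Rightarrow> (nat \<Rightarrow> (nat \<Rightarrow> real) \<Rightarrow> real) \<Rightarrow> bool" where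
  "bayes_nash_equilibrium n \<sigma> \<tau> s \<longleftrightarrow>
     (\<forall>i\<in>{1..n}. is_strategy n (s i)) \<and> (\<forall>i\<in>{1..n}. best_response n \<sigma> \<tau> i (s i) s)"

definition eta_sq :: "nat \<Rightarrow> real \<Rightarrow> real \<Rightarrow> real" where
  "eta_sq n \<sigma> \<tau> = 1 / (1 / \<sigma>\<^sup>2 + (real n - 1) / (\<sigma>\<^sup>2 + \<tau>\<^sup>2))"

definition coeff_a :: "nat \<Rightarrow> real \<Rightarrow> real \<Rightarrow> real" where
  "coeff_a n \<sigma> \<tau> = eta_sq n \<sigma> \<tau> / \<sigma>\<^sup>2"

definition coeff_b :: "nat \<Rightarrow> real \<Rightarrow> real \<Rightarrow> real" where
  "coeff_b n \<sigma> \<tau> = eta_sq n \<sigma> \<tau> / (\<sigma>\<^sup>2 + \<tau>\<^sup>2)"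

definition fixed_point_threshold_function ::
    "nat \<Rightarrow> real \<Rightarrow> real \<Rightarrow> ((nat \<Rightarrow> real) \<Rightarrow> real) \<Rightarrow> bool" where
  "fixed_point_threshold_function n \<sigma> \<tau> h \<longleftrightarrow>
     (\<forall>i\<in>{1..n}. \<forall>u\<in>Rn n. h u = 0 \<longleftrightarrow>
        coeff_a n \<sigma> \<tau> * u 1 + coeff_b n \<sigma> \<tau> * (\<Sum>p\<in>{2..n}. u p) =
        1 + (\<Sum>k\<in>{1..n} - {i}. \<P>(w in posterior n \<sigma> \<tau> i u. h (obs n k w) \<ge> 0)))"

definition symmetric_roots :: "nat \<Rightarrow> ((nat \<Rightarrow> real) \<Rightarrow> real) \<Rightarrow> bool" where
  "symmetric_roots n h \<longleftrightarrow>
     (\<forall>u\<in>Rn n. h u = 0 \<longrightarrow> (\<forall>\<pi>. \<pi> permutes {2..n} \<longrightarrow> h (u \<circ> \<pi>) = 0))"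

definition strictly_decreasing_in_each :: "nat \<Rightarrow> ((nat \<Rightarrow> real) \<Rightarrow> real) \<Rightarrow> bool" where
  "strictly_decreasing_in_each n h \<longleftrightarrow>
     (\<forall>u\<in>Rn n. \<forall>p\<in>{1..n}. \<forall>t. u p < t \<longrightarrow> h (u(p := t)) < h u)"

end

theory Submission
  imports Defs
begin

text \<open>Let \<open>F u\<close> be the posterior mean of \<open>\<theta>\<close> given \<open>y\<^sub>i = u\<close>, minus 1, minus the expected number of
  other agents with \<open>h(y\<^sub>k) \<ge> 0\<close>; the hypothesis on \<open>h\<close> says that \<open>h\<close> and \<open>F\<close> have the same roots.  As a
  function of the first coordinate alone, \<open>F\<close> is continuous, and it is an affine function with slope
  \<open>a\<^sub>n > 0\<close> up to a bounded term.  So if \<open>F u > 0\<close>, decreasing \<open>u\<^sub>1\<close> leads to a root of \<open>F\<close>, hence of \<open>h\<close>,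
  and \<open>h u < 0\<close> since \<open>h\<close> strictly decreases on the way back; symmetrically \<open>F u < 0\<close> gives \<open>h u > 0\<close>.\<close>

section \<open>Products of Gaussian densities\<close>

text \<open>Expanding the square makes the dependence on \<open>t\<close> a pure exponential factor.
  In a product of such densities the exponents therefore add up to one quadratic polynomial in
  \<open>t\<close>.\<close>

lemma normal_density_diff:
  assumes "0 < s"
  shows "normal_density 0 s (x - t) = normal_density 0 s x * exp (t * x / s\<^sup>2 - t\<^sup>2 / (2 * s\<^sup>2))"
proof -
  have "- (x - t - 0)\<^sup>2 / (2 * s\<^sup>2) = - (x - 0)\<^sup>2 / (2 * s\<^sup>2) + (t * x / s\<^sup>2 - t\<^sup>2 / (2 * s\<^sup>2))"
    using assms by (simp add: field_simps power2_eq_square)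
  then show ?thesis
    unfolding normal_density_def by (simp only: exp_add mult.assoc)
qed

lemma normal_density_swap: "normal_density 0 s (m - t) = normal_density m s t"
  by (simp add: normal_density_def power2_commute)

text \<open>This is Bayesian updating under a flat prior: precisions add, so \<open>v\<close> is the
  reciprocal of the total precision and \<open>m\<close> the precision-weighted mean of the
  observations. The factors that do not involve \<open>t\<close> form the constant in front.\<close>

lemma prod_normal_density:
  fixes x s :: "'a \<Rightarrow> real"
  assumes "finite J" and "J \<noteq> {}" and s: "\<And>q. q \<in> J \<Longrightarrow> 0 < s q"
  defines "v \<equiv> 1 / (\<Sum>q\<in>J. 1 / (s q)\<^sup>2)"
  defines "m \<equiv> v * (\<Sum>q\<in>J. x q / (s q)\<^sup>2)"
  shows "(\<Prod>q\<in>J. normal_density 0 (s q) (x q - t)) =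
    (\<Prod>q\<in>J. normal_density 0 (s q) (x q)) / normal_density 0 (sqrt v) m * normal_density m (sqrt v) t"
proof -
  have pos: "0 < (\<Sum>q\<in>J. 1 / (s q)\<^sup>2)"
    using assms(1,2) by (intro sum_pos) (auto dest!: s)
  then have v: "0 < v" by (simp add: v_def)
  have "(\<Prod>q\<in>J. normal_density 0 (s q) (x q - t)) =
    (\<Prod>q\<in>J. normal_density 0 (s q) (x q) * exp (t * x q / (s q)\<^sup>2 - t\<^sup>2 / (2 * (s q)\<^sup>2)))"
    by (intro prod.cong refl normal_density_diff s)
  also have "\<dots> = (\<Prod>q\<in>J. normal_density 0 (s q) (x q)) *
      exp (\<Sum>q\<in>J. t * x q / (s q)\<^sup>2 - t\<^sup>2 / (2 * (s q)\<^sup>2))"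
    using \<open>finite J\<close> by (simp add: prod.distrib exp_sum)
  also have "(\<Sum>q\<in>J. t * x q / (s q)\<^sup>2 - t\<^sup>2 / (2 * (s q)\<^sup>2)) =
      t * (\<Sum>q\<in>J. x q / (s q)\<^sup>2) - t\<^sup>2 / 2 * (\<Sum>q\<in>J. 1 / (s q)\<^sup>2)"
    by (simp add: sum_subtractf sum_distrib_left)
  also have "\<dots> = t * m / (sqrt v)\<^sup>2 - t\<^sup>2 / (2 * (sqrt v)\<^sup>2)"
    using v pos by (simp add: m_def v_def)
  \<comment> \<open>The summed exponent has the shape produced by \<open>normal_density_diff\<close>
    for the single observation \<open>m\<close> with deviation \<open>sqrt v\<close>, so that lemma
    is read backwards.\<close>
  also have "exp \<dots> = normal_density m (sqrt v) t / normal_density 0 (sqrt v) m"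
    using v normal_density_diff[of "sqrt v" m t] normal_density_pos[of "sqrt v" 0 m]
    by (simp add: normal_density_swap)
  finally show ?thesis by simp
qed

text \<open>Translation by \<open>t\<close> turns the integral into a convolution of centred normal
  densities, so the variances add. It serves to integrate out a hidden signal that lies between the
  fundamental \<open>t\<close> and the observed message \<open>y\<close>.\<close>

lemma nn_integral_normal_conv:
  assumes "0 < s" and "0 < r"
  shows "(\<integral>\<^sup>+x. ennreal (normal_density 0 s (x - t) * normal_density 0 r (y - x)) \<partial>lborel) =
    ennreal (normal_density 0 (sqrt (s\<^sup>2 + r\<^sup>2)) (y - t))"
proof -
  have "(\<integral>\<^sup>+x. ennreal (normal_density 0 s (x - t) * normal_density 0 r (y - x)) \<partial>lborel) =
    (\<integral>\<^sup>+x. ennreal (normal_density 0 r ((y - t) - x) * normal_density 0 s x) \<partial>lborel)"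
    by (subst nn_integral_real_affine[where c = 1 and t = t]) (auto simp: algebra_simps)
  also have "\<dots> = ennreal (normal_density 0 (sqrt (r\<^sup>2 + s\<^sup>2)) (y - t))"
    using fun_cong[OF conv_normal_density_zero_mean[OF assms(2,1)]] by simp
  finally show ?thesis by (simp add: add.commute)
qed

lemma nn_integral_normal_density_diff:
  assumes "0 < s"
  shows "(\<integral>\<^sup>+x. ennreal (normal_density 0 s (x - t)) \<partial>lborel) = 1"
proof -
  have "(\<integral>\<^sup>+x. ennreal (normal_density 0 s (x - t)) \<partial>lborel) = (\<integral>\<^sup>+x. ennreal (normal_density 0 s x) \<partial>lborel)"
    by (subst nn_integral_real_affine[where c = 1 and t = t]) auto
  also have "\<dots> = 1"
    using assms by (simp add: nn_integral_eq_integral)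
  finally show ?thesis .
qed

section \<open>The posterior of one agent\<close>

lemma borel_measurable_component:
  "v \<in> I \<Longrightarrow> (\<lambda>w. w v) \<in> borel_measurable (Pi\<^sub>M I (\<lambda>_. lborel :: real measure))"
  using measurable_component_singleton[of v I "\<lambda>_. lborel :: real measure"] by simp

lemma finite_vars: "finite (vars n)"
proof -
  have "{Msg j i |j i. j \<in> {1..n} \<and> i \<in> {1..n} \<and> j \<noteq> i} \<subseteq> (\<lambda>(j, i). Msg j i) ` ({1..n} \<times> {1..n})"
    by auto
  then have "finite {Msg j i |j i. j \<in> {1..n} \<and> i \<in> {1..n} \<and> j \<noteq> i}"
    by (rule finite_subset) simp
  then show ?thesis by (simp add: vars_def)
qed

lemma measurable_obs:
  assumes k: "k \<in> {1..n}"
  shows "obs n k \<in> measurable (Pi\<^sub>M (vars n) (\<lambda>_. borel)) (borel_Rn n)"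
proof -
  have "(\<lambda>w. if p = 1 then w (Sig k) else w (Msg (sender k p) k)) \<in> borel_measurable (Pi\<^sub>M (vars n) (\<lambda>_. borel))"
    if p: "p \<in> {1..n}" for p
  proof (cases "p = 1")
    case True
    then show ?thesis using k by (auto simp: vars_def intro: measurable_component_singleton)
  next
    case False
    then have "p \<in> {2..n}" using p by auto
    then have "sender k p \<in> {1..n} - {k}"
      using bij_betw_apply[OF bij_betw_sender[OF k]] by blast
    then show ?thesis
      using False k by (auto simp: vars_def intro: measurable_component_singleton)
  qed
  then show ?thesis
    unfolding obs_def by (intro measurable_restrict) simp
qed

locale agent =
  fixes n i :: nat and \<sigma> \<tau> :: real
  assumes i: "i \<in> {1..n}" and \<sigma>: "0 < \<sigma>" and \<tau>: "0 < \<tau>"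
begin

definition "others = {1..n} - {i}"
text \<open>The messages hidden from agent \<open>i\<close>. Those that copy the signal of
  \<open>i\<close> are among them, since only the receiver sees a message.\<close>

definition "msgs = {Msg j k |j k. j \<in> {1..n} \<and> k \<in> others \<and> j \<noteq> k}"
definition "hidden = vars n - observed n i"
definition "dens u w = joint_density n \<sigma> \<tau> (complete_config n i u w)"
text \<open>The centre of a hidden message given all signals. A copy of the signal of
  \<open>i\<close> is centred at the observed value \<open>u 1\<close>, every other one at a hidden
  variable.\<close>

definition "copied_signal u w v = (case v of Msg j k \<Rightarrow> if j = i then u 1 else w (Sig j))"
text \<open>The likelihood of the observation \<open>u\<close> given the fundamental
  \<open>t\<close>, with the signals of the other agents integrated out: a message to
  \<open>i\<close> then carries both noises, hence the variance \<sigma>^2 + \<tau>^2. Under the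
  flat prior it is also the unnormalized posterior density of \<open>Theta\<close>.\<close>

definition "theta_density u t =
  normal_density 0 \<sigma> (u 1 - t) * (\<Prod>j\<in>others. normal_density 0 (sqrt (\<sigma>\<^sup>2 + \<tau>\<^sup>2)) (u (slot i j) - t))"
definition "theta_mean u = coeff_a n \<sigma> \<tau> * u 1 + coeff_b n \<sigma> \<tau> * (\<Sum>p\<in>{2..n}. u p)"
text \<open>The normalizing constant, obtained by evaluating the proportionality of \<open>theta_density u\<close> to a
  normal density at 0.\<close>

definition "evidence u = theta_density u 0 / normal_density 0 (sqrt (eta_sq n \<sigma> \<tau>)) (theta_mean u)"

lemma finite_others [simp]: "finite others"
  by (simp add: others_def)

section \<open>The density of the hidden variables and its marginal in \<open>Theta\<close>\<close>

lemma hidden_eq: "hidden = insert Theta (Sig ` others \<union> msgs)"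
  using i by (auto simp: hidden_def vars_def observed_def others_def msgs_def)

lemma finite_hidden [simp]: "finite hidden"
  by (simp add: hidden_def finite_vars)

lemma finite_msgs [simp]: "finite msgs"
  using finite_hidden by (simp add: hidden_eq)

text \<open>Each message to \<open>i\<close> is grouped with the hidden signal that it copies, and
  the hidden messages are kept apart. In this form the variables can be integrated out in
  layers.\<close>

lemma dens_eq:
  "dens u w = normal_density 0 \<sigma> (u 1 - w Theta) *
     (\<Prod>j\<in>others. normal_density 0 \<sigma> (w (Sig j) - w Theta) * normal_density 0 \<tau> (u (slot i j) - w (Sig j))) *
     (\<Prod>v\<in>msgs. normal_density 0 \<tau> (w v - copied_signal u w v))"
proof -
  let ?c = "complete_config n i u w"
  have c: "?c Theta = w Theta" "?c (Sig i) = u 1"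
    "\<And>j. j \<in> others \<Longrightarrow> ?c (Sig j) = w (Sig j)"
    "\<And>j. j \<in> others \<Longrightarrow> ?c (Msg j i) = u (slot i j)"
    "\<And>j k. j \<in> {1..n} \<Longrightarrow> k \<in> others \<Longrightarrow> j \<noteq> k \<Longrightarrow> ?c (Msg j k) = w (Msg j k)"
    using i by (auto simp: complete_config_def vars_def observed_def others_def)
  have ins: "{1..n} = insert i others" "i \<notin> others"
    using i by (auto simp: others_def)
  have split: "(\<Prod>j\<in>{1..n}. f j) = f i * (\<Prod>j\<in>others. f j)" for f :: "nat \<Rightarrow> real"
    using ins by simp
  have msg: "?c (Msg j k) - ?c (Sig j) = w (Msg j k) - copied_signal u w (Msg j k)"
    if "j \<in> {1..n}" "k \<in> others" "j \<noteq> k" for j k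
    using that c by (cases "j = i") (simp_all add: copied_signal_def others_def)
  \<comment> \<open>The iterated product over receivers and senders is flattened to a product
    indexed by the messages themselves, which matches the product measure on
    \<open>msgs\<close>.\<close>
  have "(\<Prod>k\<in>others. \<Prod>j\<in>{1..n} - {k}. normal_density 0 \<tau> (?c (Msg j k) - ?c (Sig j))) =
    (\<Prod>(k, j)\<in>(SIGMA k:others. {1..n} - {k}). normal_density 0 \<tau> (?c (Msg j k) - ?c (Sig j)))"
    by (rule prod.Sigma) auto
  also have "\<dots> = (\<Prod>(k, j)\<in>(SIGMA k:others. {1..n} - {k}).
      normal_density 0 \<tau> (w (Msg j k) - copied_signal u w (Msg j k)))"
  proof (intro prod.cong refl)
    fix x
    assume "x \<in> (SIGMA k:others. {1..n} - {k})"
    then obtain k j where x: "x = (k, j)" and kj: "j \<in> {1..n}" "k \<in> others" "j \<noteq> k" by blast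
    show "(case x of (k, j) \<Rightarrow> normal_density 0 \<tau> (?c (Msg j k) - ?c (Sig j))) =
      (case x of (k, j) \<Rightarrow> normal_density 0 \<tau> (w (Msg j k) - copied_signal u w (Msg j k)))"
      by (simp only: x msg[OF kj] prod.case)
  qed
  also have "\<dots> = (\<Prod>v\<in>msgs. normal_density 0 \<tau> (w v - copied_signal u w v))"
    by (rule prod.reindex_bij_witness[where j = "\<lambda>(k, j). Msg j k" and i = "\<lambda>v. case v of Msg j k \<Rightarrow> (k, j)"])
      (auto simp: msgs_def others_def)
  finally have "(\<Prod>k\<in>others. \<Prod>j\<in>{1..n} - {k}. normal_density 0 \<tau> (?c (Msg j k) - ?c (Sig j))) = \<dots>" .
  moreover have "(\<Prod>j\<in>{1..n} - {i}. normal_density 0 \<tau> (?c (Msg j i) - ?c (Sig j))) =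
    (\<Prod>j\<in>others. normal_density 0 \<tau> (u (slot i j) - w (Sig j)))"
    unfolding others_def[symmetric] by (intro prod.cong refl) (simp add: c)
  moreover have "(\<Prod>j\<in>others. normal_density 0 \<sigma> (?c (Sig j) - ?c Theta)) =
    (\<Prod>j\<in>others. normal_density 0 \<sigma> (w (Sig j) - w Theta))"
    by (intro prod.cong refl) (simp add: c)
  ultimately show ?thesis
    unfolding dens_def joint_density_def
    by (simp only: split c prod.distrib mult.assoc)
qed

lemma dens_nonneg [simp]: "0 \<le> dens u w"
  unfolding dens_eq by (intro mult_nonneg_nonneg prod_nonneg) auto

lemma measurable_copied_signal:
  assumes "v \<in> msgs"
  shows "(\<lambda>w. copied_signal u w v) \<in> borel_measurable (Pi\<^sub>M hidden (\<lambda>_. lborel :: real measure))"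
proof -
  obtain j k where v: "v = Msg j k" "j \<in> {1..n}"
    using assms by (auto simp: msgs_def)
  have "Sig j \<in> hidden" if "j \<noteq> i"
    using that v by (auto simp: hidden_eq others_def)
  then show ?thesis
    using borel_measurable_component[of "Sig j" hidden] v
    by (cases "j = i") (simp_all add: copied_signal_def)
qed

lemma measurable_dens [measurable]: "dens u \<in> borel_measurable (Pi\<^sub>M hidden (\<lambda>_. lborel :: real measure))"
proof -
  note borel_measurable_component [measurable]
  have [measurable]: "(\<lambda>w. copied_signal u w v) \<in> borel_measurable (Pi\<^sub>M hidden (\<lambda>_. lborel :: real measure))"
    if "v \<in> msgs" for v using that by (rule measurable_copied_signal)
  have [simp]: "Theta \<in> hidden" "\<And>j. j \<in> others \<Longrightarrow> Sig j \<in> hidden" "\<And>v. v \<in> msgs \<Longrightarrow> v \<in> hidden"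
    by (auto simp: hidden_eq)
  show ?thesis
    unfolding dens_eq by measurable
qed

text \<open>Tonelli, with the messages innermost, then the hidden signals, then
  \<open>Theta\<close>. Each hidden message integrates to 1 whatever signal it copies, and each
  hidden signal contributes a convolution. The test function \<open>\<phi>\<close> allows both the
  normalizing constant and the law of \<open>Theta\<close> to be read off.\<close>

lemma nn_integral_dens:
  assumes [measurable]: "\<phi> \<in> borel_measurable borel"
  shows "(\<integral>\<^sup>+w. ennreal (dens u w) * \<phi> (w Theta) \<partial>Pi\<^sub>M hidden (\<lambda>_. lborel :: real measure)) =
    (\<integral>\<^sup>+t. ennreal (theta_density u t) * \<phi> t \<partial>lborel)"
proof -
  interpret product_sigma_finite "\<lambda>_::var. lborel :: real measure" ..
  let ?S = "Sig ` others"
  let ?f = "\<lambda>w. ennreal (dens u w) * \<phi> (w Theta)"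
  let ?D = "\<lambda>j t x. normal_density 0 \<sigma> (x - t) * normal_density 0 \<tau> (u (slot i j) - x)"
  have Th: "Theta \<in> hidden" by (simp add: hidden_eq)
  note borel_measurable_component[OF Th, measurable]
  have f: "?f \<in> borel_measurable (Pi\<^sub>M hidden (\<lambda>_. lborel :: real measure))"
    by measurable
  have disj: "?S \<inter> msgs = {}" "Theta \<notin> ?S \<union> msgs"
    by (auto simp: msgs_def)
  have upd: "(\<lambda>w. ?f (w(Theta := t))) \<in> borel_measurable (Pi\<^sub>M (?S \<union> msgs) (\<lambda>_. lborel :: real measure))" for t
  proof -
    have "(\<lambda>w. w(Theta := t)) \<in> measurable (Pi\<^sub>M (?S \<union> msgs) (\<lambda>_. lborel :: real measure)) (Pi\<^sub>M hidden (\<lambda>_. lborel :: real measure))"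
      unfolding hidden_eq by (rule measurable_fun_upd[where J = "?S \<union> msgs"]) auto
    from measurable_compose[OF this f] show ?thesis .
  qed
  \<comment> \<open>The centres of the messages depend only on the signals \<open>x\<close>, so for
    fixed \<open>x\<close> and \<open>t\<close> the last product has one factor per coordinate of
    \<open>y\<close>.\<close>
  have eval: "?f ((merge ?S msgs (x, y))(Theta := t)) =
      (ennreal (normal_density 0 \<sigma> (u 1 - t)) * \<phi> t * (\<Prod>j\<in>others. ennreal (?D j t (x (Sig j))))) *
      (\<Prod>v\<in>msgs. ennreal (normal_density 0 \<tau> (y v - copied_signal u x v)))" for x y t
  proof -
    let ?w = "(merge ?S msgs (x, y))(Theta := t)"
    have 0: "?w Theta = t" by simp
    have 1: "?w (Sig j) = x (Sig j)" if "j \<in> others" for j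
      using that by (auto simp: merge_def)
    have 2: "?w v = y v" "copied_signal u ?w v = copied_signal u x v" if "v \<in> msgs" for v
      using that i by (auto simp: merge_def msgs_def copied_signal_def others_def)
    have "dens u ?w = normal_density 0 \<sigma> (u 1 - t) * (\<Prod>j\<in>others. ?D j t (x (Sig j))) *
       (\<Prod>v\<in>msgs. normal_density 0 \<tau> (y v - copied_signal u x v))"
      unfolding dens_eq 0
      by (intro arg_cong2[where f = "(*)"] prod.cong refl) (simp_all only: 1 2)
    then show ?thesis
      by (simp add: ennreal_mult prod_nonneg mult_ac flip: prod_ennreal)
  qed
  have msg1: "(\<integral>\<^sup>+y. (\<Prod>v\<in>msgs. ennreal (normal_density 0 \<tau> (y v - copied_signal u x v))) \<partial>Pi\<^sub>M msgs (\<lambda>_. lborel :: real measure)) = 1" for x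
    by (subst product_nn_integral_prod) (auto simp: nn_integral_normal_density_diff \<tau>)
  have sig1: "(\<integral>\<^sup>+x. (\<Prod>j\<in>others. ennreal (?D j t (x (Sig j)))) \<partial>Pi\<^sub>M ?S (\<lambda>_. lborel :: real measure)) =
     (\<Prod>j\<in>others. ennreal (normal_density 0 (sqrt (\<sigma>\<^sup>2 + \<tau>\<^sup>2)) (u (slot i j) - t)))" for t
  proof -
    have inj: "inj_on Sig others" by (auto simp: inj_on_def)
    \<comment> \<open>The product formula for integrals wants factors indexed by variables, so the
      agent is recovered from \<open>Sig j\<close>.\<close>
    let ?g = "\<lambda>v z. ennreal (?D (case v of Sig j \<Rightarrow> j) t z)"
    have "(\<Prod>j\<in>others. ennreal (?D j t (x (Sig j)))) = (\<Prod>v\<in>?S. ?g v (x v))" for x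
      by (simp add: prod.reindex[OF inj])
    then have "(\<integral>\<^sup>+x. (\<Prod>j\<in>others. ennreal (?D j t (x (Sig j)))) \<partial>Pi\<^sub>M ?S (\<lambda>_. lborel :: real measure)) =
      (\<integral>\<^sup>+x. (\<Prod>v\<in>?S. ?g v (x v)) \<partial>Pi\<^sub>M ?S (\<lambda>_. lborel :: real measure))" by simp
    also have "\<dots> = (\<Prod>v\<in>?S. integral\<^sup>N lborel (?g v))"
      by (rule product_nn_integral_prod) auto
    also have "\<dots> = (\<Prod>j\<in>others. ennreal (normal_density 0 (sqrt (\<sigma>\<^sup>2 + \<tau>\<^sup>2)) (u (slot i j) - t)))"
      by (simp add: prod.reindex[OF inj] nn_integral_normal_conv[OF \<sigma> \<tau>])
    finally show ?thesis .
  qed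
  have mS: "(\<lambda>x. \<Prod>j\<in>others. ennreal (?D j t (x (Sig j)))) \<in> borel_measurable (Pi\<^sub>M ?S (\<lambda>_. lborel :: real measure))" for t
  proof -
    have [measurable]: "(\<lambda>x. x (Sig j)) \<in> borel_measurable (Pi\<^sub>M ?S (\<lambda>_. lborel :: real measure))"
      if "j \<in> others" for j
      using that by (intro borel_measurable_component) auto
    show ?thesis by measurable
  qed
  have mM: "(\<lambda>y. \<Prod>v\<in>msgs. ennreal (normal_density 0 \<tau> (y v - copied_signal u x v)))
      \<in> borel_measurable (Pi\<^sub>M msgs (\<lambda>_. lborel :: real measure))" for x
  proof -
    note borel_measurable_component [measurable]
    show ?thesis by measurable
  qed
  have "integral\<^sup>N (Pi\<^sub>M hidden (\<lambda>_. lborel :: real measure)) ?f =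
    (\<integral>\<^sup>+t. \<integral>\<^sup>+w. ?f (w(Theta := t)) \<partial>Pi\<^sub>M (?S \<union> msgs) (\<lambda>_. lborel) \<partial>lborel)"
    unfolding hidden_eq
    by (rule product_nn_integral_insert_rev) (use disj f in \<open>auto simp: hidden_eq\<close>)
  also have "\<dots> = (\<integral>\<^sup>+t. ennreal (theta_density u t) * \<phi> t \<partial>lborel)"
  proof (rule nn_integral_cong)
    fix t :: real
    have "(\<integral>\<^sup>+w. ?f (w(Theta := t)) \<partial>Pi\<^sub>M (?S \<union> msgs) (\<lambda>_. lborel :: real measure)) =
      (\<integral>\<^sup>+x. \<integral>\<^sup>+y. ?f ((merge ?S msgs (x, y))(Theta := t)) \<partial>Pi\<^sub>M msgs (\<lambda>_. lborel) \<partial>Pi\<^sub>M ?S (\<lambda>_. lborel :: real measure))"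
      by (rule product_nn_integral_fold) (use disj upd in auto)
    also have "\<dots> = (\<integral>\<^sup>+x. ennreal (normal_density 0 \<sigma> (u 1 - t)) * \<phi> t *
        (\<Prod>j\<in>others. ennreal (?D j t (x (Sig j)))) \<partial>Pi\<^sub>M ?S (\<lambda>_. lborel :: real measure))"
      unfolding eval by (subst nn_integral_cmult[OF mM]) (simp add: msg1)
    also have "\<dots> = ennreal (theta_density u t) * \<phi> t"
      unfolding nn_integral_cmult[OF mS] sig1
      by (simp add: theta_density_def ennreal_mult prod_nonneg mult_ac flip: prod_ennreal)
    finally show "(\<integral>\<^sup>+w. ?f (w(Theta := t)) \<partial>Pi\<^sub>M (?S \<union> msgs) (\<lambda>_. lborel :: real measure)) = ennreal (theta_density u t) * \<phi> t" .
  qed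
  finally show ?thesis .
qed

section \<open>The Gaussian posterior of \<open>Theta\<close>\<close>

lemma eta_sq_pos: "0 < eta_sq n \<sigma> \<tau>"
  using i \<sigma> \<tau> by (auto simp: eta_sq_def intro!: add_pos_nonneg)

text \<open>Given \<open>Theta\<close>, the coordinates of \<open>u\<close> act as independent
  normal observations of it, the first with variance \<sigma>^2 and the others with \<sigma>^2 +
  \<tau>^2. Hence \<open>prod_normal_density\<close> applies, with \<open>eta_sq\<close> as the
  combined variance and \<open>theta_mean\<close> as the combined mean.\<close>

lemma theta_density_eq:
  "theta_density u t = evidence u * normal_density (theta_mean u) (sqrt (eta_sq n \<sigma> \<tau>)) t"
proof -
  let ?r = "sqrt (\<sigma>\<^sup>2 + \<tau>\<^sup>2)"
  define s where "s p = (if p = 1 then \<sigma> else ?r)" for p :: nat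
  have ins: "{1..n} = insert 1 {2..n}" using i by auto
  have bij: "bij_betw (slot i) others {2..n}"
    unfolding others_def
    by (rule bij_betw_byWitness[where f' = "sender i"])
      (use i in \<open>auto simp: sender_def slot_def\<close>)
  have s2: "\<And>p. p \<in> {2..n} \<Longrightarrow> s p = ?r"
    by (auto simp: s_def)
  have prod: "theta_density u t = (\<Prod>p\<in>{1..n}. normal_density 0 (s p) (u p - t))" for t
  proof -
    have "(\<Prod>j\<in>others. normal_density 0 ?r (u (slot i j) - t)) = (\<Prod>p\<in>{2..n}. normal_density 0 ?r (u p - t))"
      by (rule prod.reindex_bij_betw[OF bij])
    also have "\<dots> = (\<Prod>p\<in>{2..n}. normal_density 0 (s p) (u p - t))"
      by (intro prod.cong) (auto simp: s2)
    finally show ?thesis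
      unfolding theta_density_def ins by (simp add: s_def)
  qed
  have sum: "(\<Sum>p\<in>{1..n}. f p / (s p)\<^sup>2) = f 1 / \<sigma>\<^sup>2 + (\<Sum>p\<in>{2..n}. f p / (\<sigma>\<^sup>2 + \<tau>\<^sup>2))" for f
  proof -
    have "(\<Sum>p\<in>{2..n}. f p / (s p)\<^sup>2) = (\<Sum>p\<in>{2..n}. f p / (\<sigma>\<^sup>2 + \<tau>\<^sup>2))"
      by (intro sum.cong) (auto simp: s2)
    then show ?thesis
      unfolding ins by (simp add: s_def)
  qed
  have "(\<Sum>p\<in>{1..n}. 1 / (s p)\<^sup>2) = 1 / \<sigma>\<^sup>2 + (\<Sum>p\<in>{2..n}. 1 / (\<sigma>\<^sup>2 + \<tau>\<^sup>2))"
    by (rule sum)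
  also have "\<dots> = 1 / eta_sq n \<sigma> \<tau>"
    using i by (simp add: eta_sq_def of_nat_diff)
  finally have v: "1 / (\<Sum>p\<in>{1..n}. 1 / (s p)\<^sup>2) = eta_sq n \<sigma> \<tau>" by simp
  have "(\<Sum>p\<in>{1..n}. u p / (s p)\<^sup>2) = u 1 / \<sigma>\<^sup>2 + (\<Sum>p\<in>{2..n}. u p / (\<sigma>\<^sup>2 + \<tau>\<^sup>2))"
    by (rule sum)
  also have "\<dots> = u 1 / \<sigma>\<^sup>2 + (\<Sum>p\<in>{2..n}. u p) / (\<sigma>\<^sup>2 + \<tau>\<^sup>2)"
    by (simp add: sum_divide_distrib)
  finally have m: "eta_sq n \<sigma> \<tau> * (\<Sum>p\<in>{1..n}. u p / (s p)\<^sup>2) = theta_mean u"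
    by (simp add: theta_mean_def coeff_a_def coeff_b_def algebra_simps)
  have "theta_density u t = (\<Prod>p\<in>{1..n}. normal_density 0 (s p) (u p)) /
      normal_density 0 (sqrt (eta_sq n \<sigma> \<tau>)) (theta_mean u) *
      normal_density (theta_mean u) (sqrt (eta_sq n \<sigma> \<tau>)) t"
    \<comment> \<open>The variance and the mean are turned back into sums of precisions, the form in
      which \<open>prod_normal_density\<close> provides them.\<close>
    unfolding prod v[symmetric] m[unfolded v[symmetric], symmetric]
    by (rule prod_normal_density) (use i \<sigma> in \<open>auto simp: s_def intro: add_pos_nonneg\<close>)
  then show ?thesis
    by (simp add: evidence_def prod[of 0])
qed

lemma evidence_pos: "0 < evidence u"
proof -
  have "0 < sqrt (\<sigma>\<^sup>2 + \<tau>\<^sup>2)" using \<sigma> by (auto intro: add_pos_nonneg)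
  then show ?thesis
    unfolding evidence_def theta_density_def using \<sigma> eta_sq_pos
    by (intro divide_pos_pos mult_pos_pos prod_pos ballI normal_density_pos) auto
qed

text \<open>The normalizing integral equals \<open>evidence u\<close>, by
  \<open>nn_integral_dens\<close> with constant test function. Being finite and positive, it turns
  the extended quotient in \<open>posterior\<close> into a real one.\<close>

lemma posterior_eq:
  "posterior n \<sigma> \<tau> i u = distr
     (density (Pi\<^sub>M hidden (\<lambda>_. lborel :: real measure)) (\<lambda>w. ennreal (dens u w / evidence u)))
     (Pi\<^sub>M (vars n) (\<lambda>_. borel)) (complete_config n i u)"
proof -
  have "(\<integral>\<^sup>+w. ennreal (dens u w) \<partial>Pi\<^sub>M hidden (\<lambda>_. lborel :: real measure)) = (\<integral>\<^sup>+t. ennreal (theta_density u t) \<partial>lborel)"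
    using nn_integral_dens[of "\<lambda>_. 1" u] by simp
  also have "\<dots> = ennreal (evidence u) *
      (\<integral>\<^sup>+t. ennreal (normal_density (theta_mean u) (sqrt (eta_sq n \<sigma> \<tau>)) t) \<partial>lborel)"
    unfolding theta_density_eq using evidence_pos[of u]
    by (simp add: ennreal_mult nn_integral_cmult)
  also have "\<dots> = ennreal (evidence u)"
    using eta_sq_pos by (simp add: nn_integral_eq_integral)
  finally have "(\<integral>\<^sup>+w. ennreal (dens u w) \<partial>Pi\<^sub>M hidden (\<lambda>_. lborel :: real measure)) = ennreal (evidence u)" .
  then show ?thesis
    unfolding posterior_def Let_def hidden_def[symmetric] dens_def[symmetric]
    by (simp add: divide_ennreal evidence_pos)
qed

lemma measurable_complete_config [measurable]:
  "complete_config n i u \<in> measurable (Pi\<^sub>M hidden (\<lambda>_. lborel :: real measure)) (Pi\<^sub>M (vars n) (\<lambda>_. borel))"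
proof -
  have "(\<lambda>w. if v \<in> observed n i then c else w v) \<in> borel_measurable (Pi\<^sub>M hidden (\<lambda>_. lborel :: real measure))"
    if "v \<in> vars n" for v and c :: real
  proof (cases "v \<in> observed n i")
    case False
    then have "v \<in> hidden" using that by (simp add: hidden_def)
    then show ?thesis
      using borel_measurable_component[of v hidden] False by simp
  qed simp
  then show ?thesis
    unfolding complete_config_def by (intro measurable_restrict) simp
qed

text \<open>The constant \<open>evidence u\<close> cancels against the one in
  \<open>theta_density_eq\<close>. The outcome is that \<open>Theta\<close> is normal under the
  posterior, with mean \<open>theta_mean u\<close> and variance
  \<open>eta_sq n \<sigma> \<tau>\<close>.\<close>

lemma nn_integral_dens_evidence:
  assumes [measurable]: "\<phi> \<in> borel_measurable borel"
  shows "(\<integral>\<^sup>+w. ennreal (dens u w / evidence u) * \<phi> (w Theta) \<partial>Pi\<^sub>M hidden (\<lambda>_. lborel :: real measure)) =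
    (\<integral>\<^sup>+t. ennreal (normal_density (theta_mean u) (sqrt (eta_sq n \<sigma> \<tau>)) t) * \<phi> t \<partial>lborel)"
proof -
  have *: "ennreal (dens u w / evidence u) * \<phi> t = ennreal (dens u w) * (ennreal (inverse (evidence u)) * \<phi> t)" for w t
    using evidence_pos[of u] by (simp add: divide_inverse ennreal_mult mult_ac)
  have **: "ennreal (theta_density u t) * (ennreal (inverse (evidence u)) * \<phi> t) =
    ennreal (normal_density (theta_mean u) (sqrt (eta_sq n \<sigma> \<tau>)) t) * \<phi> t" for t
    using evidence_pos[of u]
    by (simp add: mult.assoc[symmetric] ennreal_mult''[symmetric] theta_density_eq field_simps)
  show ?thesis
    unfolding * using nn_integral_dens[of "\<lambda>t. ennreal (inverse (evidence u)) * \<phi> t" u]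
    by (simp add: **)
qed

lemma nn_integral_posterior_density:
  "(\<integral>\<^sup>+w. ennreal (dens u w / evidence u) \<partial>Pi\<^sub>M hidden (\<lambda>_. lborel :: real measure)) = 1"
  using nn_integral_dens_evidence[of "\<lambda>_. 1" u] eta_sq_pos by (simp add: nn_integral_eq_integral)

lemma prob_space_posterior: "prob_space (posterior n \<sigma> \<tau> i u)"
proof -
  have "prob_space (density (Pi\<^sub>M hidden (\<lambda>_. lborel :: real measure)) (\<lambda>w. ennreal (dens u w / evidence u)))"
    by (rule prob_spaceI)
      (simp add: emeasure_density nn_integral_posterior_density cong: nn_integral_cong)
  then show ?thesis
    unfolding posterior_eq by (rule prob_space.prob_space_distr) simp
qed

text \<open>The law of \<open>Theta\<close> is identified with a normal law set by set, taking
  indicators as test functions; its expectation is then the mean parameter.\<close>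

lemma integral_posterior_Theta: "(\<integral>w. w Theta \<partial>posterior n \<sigma> \<tau> i u) = theta_mean u"
proof -
  interpret prob_space "posterior n \<sigma> \<tau> i u" by (rule prob_space_posterior)
  have Th: "Theta \<in> vars n" by (simp add: vars_def)
  have [measurable]: "(\<lambda>w. w Theta) \<in> borel_measurable (Pi\<^sub>M hidden (\<lambda>_. lborel :: real measure))"
    by (intro borel_measurable_component) (simp add: hidden_eq)
  have [measurable]: "(\<lambda>w. w Theta) \<in> borel_measurable (Pi\<^sub>M (vars n) (\<lambda>_. borel :: real measure))"
    using measurable_component_singleton[OF Th] .
  have eq: "complete_config n i u w Theta = w Theta" for w
    by (simp add: complete_config_def Th observed_def)
  have [measurable]: "(\<lambda>w. w Theta) \<in> borel_measurable (posterior n \<sigma> \<tau> i u)"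
    unfolding posterior_eq by simp
  have "distr (posterior n \<sigma> \<tau> i u) lborel (\<lambda>w. w Theta) =
      density lborel (normal_density (theta_mean u) (sqrt (eta_sq n \<sigma> \<tau>)))"
  proof (rule measure_eqI)
    fix A :: "real set"
    assume "A \<in> sets (distr (posterior n \<sigma> \<tau> i u) lborel (\<lambda>w. w Theta))"
    then have A [measurable]: "A \<in> sets borel" by simp
    let ?P = "Pi\<^sub>M hidden (\<lambda>_::var. lborel :: real measure)"
    let ?D = "density ?P (\<lambda>w. ennreal (dens u w / evidence u))"
    have "distr (posterior n \<sigma> \<tau> i u) lborel (\<lambda>w. w Theta) = distr ?D lborel (\<lambda>w. w Theta)"
      unfolding posterior_eq by (subst distr_distr) (auto simp: comp_def eq)
    then have "emeasure (distr (posterior n \<sigma> \<tau> i u) lborel (\<lambda>w. w Theta)) A =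
        emeasure ?D ((\<lambda>w. w Theta) -` A \<inter> space ?P)"
      by (simp add: emeasure_distr)
    also have "\<dots> = (\<integral>\<^sup>+w. ennreal (dens u w / evidence u) * indicator A (w Theta) \<partial>?P)"
      by (subst emeasure_density) (auto intro!: nn_integral_cong simp: indicator_def)
    also have "\<dots> = emeasure (density lborel (normal_density (theta_mean u) (sqrt (eta_sq n \<sigma> \<tau>)))) A"
      by (subst nn_integral_dens_evidence) (auto simp: emeasure_density)
    finally show "emeasure (distr (posterior n \<sigma> \<tau> i u) lborel (\<lambda>w. w Theta)) A = \<dots>" .
  qed simp
  then have "distributed (posterior n \<sigma> \<tau> i u) lborel (\<lambda>w. w Theta)
      (normal_density (theta_mean u) (sqrt (eta_sq n \<sigma> \<tau>)))"
    by (simp add: distributed_def)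
  then show ?thesis
    using eta_sq_pos by (intro normal_distributed_expectation[of "sqrt (eta_sq n \<sigma> \<tau>)"]) auto
qed

section \<open>Posterior probabilities of what the other agents observe\<close>

lemma obs_other:
  assumes "k \<in> others"
  shows "obs n k (complete_config n i u w) = obs n k w"
proof
  have k: "k \<in> {1..n}" "k \<noteq> i" using assms by (auto simp: others_def)
  \<comment> \<open>Neither the signal of \<open>k\<close> nor any message sent to \<open>k\<close>
    is observed by \<open>i\<close>, so inserting the values \<open>u\<close> does not affect
    them.\<close>
  have c: "complete_config n i u w (Sig k) = w (Sig k)"
    using k by (auto simp: complete_config_def vars_def observed_def)
  have "complete_config n i u w (Msg (sender k p) k) = w (Msg (sender k p) k)"
    if "p \<in> {1..n}" "p \<noteq> 1" for p
  proof -
    have "p \<in> {2..n}" using that by auto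
    then have "sender k p \<in> {1..n} - {k}"
      using bij_betw_apply[OF bij_betw_sender[OF k(1)]] by blast
    then show ?thesis
      using k by (auto simp: complete_config_def vars_def observed_def)
  qed
  then show "obs n k (complete_config n i u w) p = obs n k w p" for p
    using c by (simp add: obs_def)
qed

lemma measurable_obs_hidden:
  assumes "k \<in> others"
  shows "obs n k \<in> measurable (Pi\<^sub>M hidden (\<lambda>_. lborel :: real measure)) (borel_Rn n)"
proof -
  have "obs n k \<in> measurable (Pi\<^sub>M (vars n) (\<lambda>_. borel)) (borel_Rn n)"
    using assms by (intro measurable_obs) (simp add: others_def)
  from measurable_compose[OF measurable_complete_config this] show ?thesis
    by (simp add: obs_other[OF assms])
qed

text \<open>Pulled back to the hidden variables, the event is free of \<open>u\<close> by
  \<open>obs_other\<close>. The observation enters through the density alone.\<close>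

lemma prob_posterior_obs:
  assumes k: "k \<in> others" and A [measurable]: "A \<in> sets (borel_Rn n)"
  shows "measure (posterior n \<sigma> \<tau> i u) {w \<in> space (posterior n \<sigma> \<tau> i u). obs n k w \<in> A} =
    (\<integral>w. dens u w / evidence u * indicator A (obs n k w) \<partial>Pi\<^sub>M hidden (\<lambda>_. lborel :: real measure))"
proof -
  let ?P = "Pi\<^sub>M hidden (\<lambda>_::var. lborel :: real measure)"
  let ?D = "density ?P (\<lambda>w. ennreal (dens u w / evidence u))"
  have kn: "k \<in> {1..n}" using k by (simp add: others_def)
  note [measurable] = measurable_obs[OF kn] measurable_obs_hidden[OF k]
  let ?V = "Pi\<^sub>M (vars n) (\<lambda>_. borel :: real measure)"
  have "measure (posterior n \<sigma> \<tau> i u) {w \<in> space (posterior n \<sigma> \<tau> i u). obs n k w \<in> A} =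
    measure ?D (complete_config n i u -` {w \<in> space ?V. obs n k w \<in> A} \<inter> space ?P)"
    unfolding posterior_eq by (subst measure_distr) auto
  also have "complete_config n i u -` {w \<in> space ?V. obs n k w \<in> A} \<inter> space ?P =
      {w \<in> space ?P. obs n k w \<in> A}"
    using measurable_space[OF measurable_complete_config] by (auto simp: obs_other[OF k])
  also have "measure ?D \<dots> = (\<integral>w. indicator {w \<in> space ?P. obs n k w \<in> A} w \<partial>?D)"
    by (simp add: Int_absorb2 Collect_conj_eq)
  also have "\<dots> = (\<integral>w. dens u w / evidence u * indicator A (obs n k w) \<partial>?P)"
    using evidence_pos[of u]
    by (subst integral_density) (auto intro!: Bochner_Integration.integral_cong simp: indicator_def)
  finally show ?thesis .
qed

section \<open>Continuity of these probabilities in the own signal\<close>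

lemma integrable_posterior_density:
  "integrable (Pi\<^sub>M hidden (\<lambda>_. lborel :: real measure)) (\<lambda>w. dens u w / evidence u)"
  using nn_integral_posterior_density[of u] evidence_pos[of u]
  by (intro integrableI_nonneg) (auto simp: less_imp_le)

lemma slot_neq_1: "j \<in> others \<Longrightarrow> slot i j \<noteq> 1"
  using i by (auto simp: slot_def others_def)

text \<open>The coordinate \<open>u 1\<close> enters \<open>dens\<close> through the noise of the
  own signal and through the centres of the messages that copy it, while the messages received sit
  in other coordinates by \<open>slot_neq_1\<close>. All factors are continuous, and the limit of
  the denominators is positive.\<close>

lemma tendsto_posterior_density:
  assumes t: "t \<longlonglongrightarrow> t0"
  shows "(\<lambda>m. dens (u(1 := t m)) w / evidence (u(1 := t m))) \<longlonglongrightarrow> dens (u(1 := t0)) w / evidence (u(1 := t0))"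
proof -
  have N: "(\<lambda>m. normal_density a r (f m)) \<longlonglongrightarrow> normal_density a r l" if "f \<longlonglongrightarrow> l" for f :: "nat \<Rightarrow> real" and a r l
    unfolding normal_density_def divide_inverse
    by (intro tendsto_mult tendsto_const tendsto_exp tendsto_minus tendsto_power tendsto_diff that)
  have s: "(\<lambda>m. (u(1 := t m)) (slot i j)) \<longlonglongrightarrow> (u(1 := t0)) (slot i j)" if "j \<in> others" for j
    using slot_neq_1[OF that] by simp
  have c: "(\<lambda>m. copied_signal (u(1 := t m)) w v) \<longlonglongrightarrow> copied_signal (u(1 := t0)) w v" if "v \<in> msgs" for v
    using that t by (auto simp: msgs_def copied_signal_def)
  have d: "(\<lambda>m. dens (u(1 := t m)) w) \<longlonglongrightarrow> dens (u(1 := t0)) w"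
    unfolding dens_eq by (intro tendsto_intros N s c) (simp_all add: t)
  have th: "(\<lambda>m. theta_density (u(1 := t m)) 0) \<longlonglongrightarrow> theta_density (u(1 := t0)) 0"
    unfolding theta_density_def by (intro tendsto_intros N s) (simp_all add: t)
  have "(\<lambda>m. theta_mean (u(1 := t m))) \<longlonglongrightarrow> theta_mean (u(1 := t0))"
    unfolding theta_mean_def by (intro tendsto_intros) (simp_all add: t)
  moreover have "normal_density 0 (sqrt (eta_sq n \<sigma> \<tau>)) z \<noteq> 0" for z
    using normal_density_pos[of "sqrt (eta_sq n \<sigma> \<tau>)" 0 z] eta_sq_pos by simp
  ultimately have e: "(\<lambda>m. evidence (u(1 := t m))) \<longlonglongrightarrow> evidence (u(1 := t0))"
    unfolding evidence_def by (intro tendsto_divide th N)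
  have "evidence (u(1 := t0)) \<noteq> 0" using evidence_pos[of "u(1 := t0)"] by simp
  with d e show ?thesis by (intro tendsto_divide)
qed

text \<open>The integrand over the hidden variables depends on the observation only through the density,
  since agents observe disjoint sets of variables.  So pointwise convergence of the densities
  and Scheffe's lemma suffice, and no regularity of the event is needed.\<close>

lemma tendsto_prob_posterior_obs:
  fixes u :: "nat \<Rightarrow> real"
  assumes k: "k \<in> others" and A: "A \<in> sets (borel_Rn n)" and t: "t \<longlonglongrightarrow> t0"
  defines "P \<equiv> \<lambda>t. measure (posterior n \<sigma> \<tau> i (u(1 := t))) {w \<in> space (posterior n \<sigma> \<tau> i (u(1 := t))). obs n k w \<in> A}"
  shows "(\<lambda>m. P (t m)) \<longlonglongrightarrow> P t0"
proof -
  let ?L = "Pi\<^sub>M hidden (\<lambda>_::var. lborel :: real measure)"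
  define f where "f t w = dens (u(1 := t)) w / evidence (u(1 := t))" for t w
  let ?I = "\<lambda>w. indicator A (obs n k w) :: real"
  note [measurable] = A measurable_obs_hidden[OF k]
  have int: "integrable ?L (f t)" for t
    unfolding f_def by (rule integrable_posterior_density)
  have nonneg: "0 \<le> f t w" for t w
    unfolding f_def using evidence_pos by (simp add: less_imp_le)
  have one: "(\<integral>\<^sup>+w. norm (f t w) \<partial>?L) = 1" for t
    using nn_integral_posterior_density[of "u(1 := t)", folded f_def] nonneg by simp
  have L1: "(\<lambda>m. \<integral>\<^sup>+w. norm (f (t m) w - f t0 w) \<partial>?L) \<longlonglongrightarrow> 0"
  proof (rule Scheffe_lemma1)
    show "AE w in ?L. (\<lambda>m. f (t m) w) \<longlonglongrightarrow> f t0 w"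
      unfolding f_def using t by (intro AE_I2 tendsto_posterior_density)
    \<comment> \<open>All densities have total mass 1, so both sides equal 1.\<close>
    show "limsup (\<lambda>m. \<integral>\<^sup>+w. norm (f (t m) w) \<partial>?L) \<le> (\<integral>\<^sup>+w. norm (f t0 w) \<partial>?L)"
      unfolding one by (simp add: Limsup_const)
  qed (rule int)+
  have intI: "integrable ?L (\<lambda>w. f t w * ?I w)" for t
    by (rule Bochner_Integration.integrable_bound[OF int[of t]])
      (use int[of t] in \<open>auto simp: indicator_def\<close>)
  have "(\<lambda>m. \<integral>w. f (t m) w * ?I w \<partial>?L) \<longlonglongrightarrow> (\<integral>w. f t0 w * ?I w \<partial>?L)"
  proof (rule tendsto_L1_int)
    \<comment> \<open>Multiplying by an indicator cannot increase the distance in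
      \<open>L1\<close>.\<close>
    show "(\<lambda>m. \<integral>\<^sup>+w. norm (f (t m) w * ?I w - f t0 w * ?I w) \<partial>?L) \<longlonglongrightarrow> 0"
      by (rule tendsto_sandwich[OF _ _ tendsto_const L1])
        (auto intro!: always_eventually nn_integral_mono simp: indicator_def)
  qed (rule intI)+
  then show ?thesis
    unfolding P_def prob_posterior_obs[OF k A] f_def .
qed

end

text \<open>Continuity refers to the topology on all functions from the naturals, measurability to
  the product over \<open>{1..n}\<close>. The map \<open>?e\<close> links them: it is the identity
  on \<open>Rn n\<close>, and its coordinates outside \<open>{1..n}\<close> are constant, so it is
  measurable into the full countable product, whose sigma-algebra is the Borel one.\<close>

lemma borel_measurable_continuous_on_Rn:
  fixes h :: "(nat \<Rightarrow> real) \<Rightarrow> real"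
  assumes "continuous_on (Rn n) h"
  shows "h \<in> borel_measurable (borel_Rn n)"
proof -
  let ?e = "\<lambda>u p. if p \<in> {1..n} then u p else undefined :: real"
  have "?e \<in> measurable (borel_Rn n) (Pi\<^sub>M UNIV (\<lambda>_. borel))"
  proof (rule measurable_PiM_single')
    fix p :: nat
    show "(\<lambda>u. if p \<in> {1..n} then u p else undefined) \<in> borel_measurable (borel_Rn n)"
      by (cases "p \<in> {1..n}") (auto intro: measurable_component_singleton)
  qed auto
  then have "?e \<in> borel_measurable (borel_Rn n)"
    by (simp cong: measurable_cong_sets add: sets_PiM_equal_borel)
  then have "?e \<in> measurable (borel_Rn n) (restrict_space borel (Rn n))"
    by (intro measurable_restrict_space2) (auto simp: space_PiM PiE_def extensional_def)
  from measurable_compose[OF this borel_measurable_continuous_on_restrict[OF assms]]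
  have "(\<lambda>u. h (?e u)) \<in> borel_measurable (borel_Rn n)" .
  moreover have "h u = h (?e u)" if "u \<in> space (borel_Rn n)" for u
    using that by (intro arg_cong[where f = h]) (auto simp: space_PiM PiE_def extensional_def)
  ultimately show ?thesis
    by (subst measurable_cong)
qed

section \<open>The threshold equilibrium\<close>

theorem theorem6:
  fixes n :: nat and \<sigma> \<tau> :: real and h :: "(nat \<Rightarrow> real) \<Rightarrow> real"
  assumes "n \<ge> 2" and "\<sigma> > 0" and "\<tau> > 0"
    and "continuous_on (Rn n) h"
    and "strictly_decreasing_in_each n h"
    and "symmetric_roots n h"
    and "fixed_point_threshold_function n \<sigma> \<tau> h"
  shows "bayes_nash_equilibrium n \<sigma> \<tau> (\<lambda>i u. if h u \<ge> 0 then 1 else 0)"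
proof -
  let ?s = "\<lambda>u. if h u \<ge> 0 then 1 else 0 :: real"
  have h [measurable]: "h \<in> borel_measurable (borel_Rn n)"
    using assms(4) by (rule borel_measurable_continuous_on_Rn)
  have "?s \<in> borel_measurable (borel_Rn n)"
    by measurable
  then have strategy: "is_strategy n ?s"
    unfolding is_strategy_def by simp
  define A where "A = {u \<in> space (borel_Rn n). h u \<ge> 0}"
  have A [measurable]: "A \<in> sets (borel_Rn n)"
    unfolding A_def by measurable
  have obs_A: "obs n k w \<in> A \<longleftrightarrow> h (obs n k w) \<ge> 0" for k w
    by (simp add: A_def obs_def space_PiM)
  have "best_response n \<sigma> \<tau> i ?s (\<lambda>_. ?s)" if i: "i \<in> {1..n}" for i
  proof -
    interpret agent n i \<sigma> \<tau>
      using i assms by unfold_locales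
    define P where "P u k = \<P>(w in posterior n \<sigma> \<tau> i u. h (obs n k w) \<ge> 0)" for u k
    define F where "F u = theta_mean u - 1 - (\<Sum>k\<in>others. P u k)" for u
    have root: "h u = 0 \<longleftrightarrow> F u = 0" if "u \<in> Rn n" for u
      using assms(7) i that
      by (auto simp: fixed_point_threshold_function_def F_def P_def theta_mean_def others_def)
    have P_bounds: "0 \<le> P u k" "P u k \<le> 1" for u k
      using prob_space.prob_le_1[OF prob_space_posterior] by (auto simp: P_def)
    have expect: "(\<integral>w. (\<Sum>j\<in>others. ?s (obs n j w)) \<partial>posterior n \<sigma> \<tau> i u) = (\<Sum>k\<in>others. P u k)" for u
    proof -
      interpret prob_space "posterior n \<sigma> \<tau> i u" by (rule prob_space_posterior)
      have [measurable_cong]: "sets (posterior n \<sigma> \<tau> i u) = sets (Pi\<^sub>M (vars n) (\<lambda>_. borel))"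
        by (simp add: posterior_eq)
      \<comment> \<open>The threshold strategy is an indicator, so the expected number of risky
        actions is a sum of probabilities.\<close>
      have ind: "?s (obs n j w) = indicator {w \<in> space (posterior n \<sigma> \<tau> i u). h (obs n j w) \<ge> 0} w"
        if "w \<in> space (posterior n \<sigma> \<tau> i u)" for j w using that by simp
      have E: "{w \<in> space (posterior n \<sigma> \<tau> i u). h (obs n j w) \<ge> 0} \<in> events" if "j \<in> others" for j
      proof -
        have [measurable]: "obs n j \<in> measurable (Pi\<^sub>M (vars n) (\<lambda>_. borel)) (borel_Rn n)"
          using that by (intro measurable_obs) (simp add: others_def)
        show ?thesis by measurable
      qed
      have "(\<integral>w. (\<Sum>j\<in>others. ?s (obs n j w)) \<partial>posterior n \<sigma> \<tau> i u) =
        (\<integral>w. (\<Sum>j\<in>others. indicator {w \<in> space (posterior n \<sigma> \<tau> i u). h (obs n j w) \<ge> 0} w) \<partial>posterior n \<sigma> \<tau> i u)"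
        by (intro Bochner_Integration.integral_cong refl sum.cong ind)
      also have "\<dots> = (\<Sum>j\<in>others. P u j)"
        using E by (subst Bochner_Integration.integral_sum) (auto simp: P_def emeasure_eq_measure intro!: sum.cong arg_cong[where f = prob])
      finally show ?thesis .
    qed
    have cont: "continuous_on S (\<lambda>t. F (u(1 := t)))" for S u
    proof -
      have "continuous_on S (\<lambda>t. P (u(1 := t)) k)" if "k \<in> others" for k
        unfolding continuous_on_sequentially comp_def P_def obs_A[symmetric]
        using tendsto_prob_posterior_obs[OF that A] by blast
      moreover have "continuous_on S (\<lambda>t. theta_mean (u(1 := t)))"
        unfolding theta_mean_def by (intro continuous_intros) auto
      ultimately show ?thesis
        unfolding F_def by (intro continuous_intros) auto
    qed
    have a: "0 < coeff_a n \<sigma> \<tau>"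
      using eta_sq_pos \<sigma> by (simp add: coeff_a_def)
    \<comment> \<open>The posterior mean is affine in \<open>t\<close>, and the sum of probabilities
      lies between 0 and the number of other agents.\<close>
    have F_bounds: "coeff_a n \<sigma> \<tau> * t + b - 1 - real (card others) \<le> F (u(1 := t))"
      "F (u(1 := t)) \<le> coeff_a n \<sigma> \<tau> * t + b - 1"
      if "b = coeff_b n \<sigma> \<tau> * (\<Sum>p\<in>{2..n}. u p)" for u t b
    proof -
      have "theta_mean (u(1 := t)) = coeff_a n \<sigma> \<tau> * t + b"
        unfolding theta_mean_def that by simp
      moreover have "(\<Sum>k\<in>others. P (u(1 := t)) k) \<le> real (card others)"
        using sum_bounded_above[of others "P (u(1 := t))" 1] P_bounds by simp
      moreover have "0 \<le> (\<Sum>k\<in>others. P (u(1 := t)) k)"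
        by (intro sum_nonneg P_bounds)
      ultimately show "coeff_a n \<sigma> \<tau> * t + b - 1 - real (card others) \<le> F (u(1 := t))"
        "F (u(1 := t)) \<le> coeff_a n \<sigma> \<tau> * t + b - 1"
        unfolding F_def by linarith+
    qed
    have dec: "h (u(1 := t)) < h (u(1 := t'))" if "u \<in> Rn n" "t' < t" for u t t'
    proof -
      \<comment> \<open>Strict decrease compares a point with an update of it; the base point taken
        here is \<open>u(1 := t')\<close>, updated to \<open>t\<close>.\<close>
      have "u(1 := t') \<in> Rn n" using that(1) i by (auto simp: PiE_def extensional_def)
      then show ?thesis
        using assms(1,5) that(2) unfolding strictly_decreasing_in_each_def by force
    qed
    have mem: "u(1 := t) \<in> Rn n" if "u \<in> Rn n" for u t
      using that i by (auto simp: PiE_def extensional_def)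
    have neg: "h u < 0" if u: "u \<in> Rn n" and F: "0 < F u" for u
    proof -
      define b where "b = coeff_b n \<sigma> \<tau> * (\<Sum>p\<in>{2..n}. u p)"
      \<comment> \<open>The second argument is the zero of the affine upper bound, so
        \<open>F\<close> is nonpositive there and further left; the minimum keeps \<open>t\<close>
        on the left of \<open>u 1\<close>.\<close>
      define t where "t = min (u 1) ((1 - b) / coeff_a n \<sigma> \<tau>)"
      have "coeff_a n \<sigma> \<tau> * t \<le> 1 - b"
        using a by (auto simp: t_def field_simps min_def)
      then have "F (u(1 := t)) \<le> 0"
        using F_bounds(2)[OF b_def, of t] by linarith
      moreover have "t \<le> u 1" by (simp add: t_def)
      ultimately obtain r where r: "r \<le> u 1" "F (u(1 := r)) = 0"
        using IVT'[of "\<lambda>t. F (u(1 := t))" t 0 "u 1"] F cont by auto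
      \<comment> \<open>Equality would give \<open>u(1 := r) = u\<close>, where \<open>F\<close> is
        positive.\<close>
      then have "r < u 1" using F by (cases "r = u 1") auto
      moreover have "h (u(1 := r)) = 0"
        using root[OF mem[OF u]] r by simp
      ultimately show ?thesis
        using dec[OF u, of r "u 1"] by simp
    qed
    have pos: "0 < h u" if u: "u \<in> Rn n" and F: "F u < 0" for u
    proof -
      define b where "b = coeff_b n \<sigma> \<tau> * (\<Sum>p\<in>{2..n}. u p)"
      \<comment> \<open>Here the zero of the affine lower bound is used, which lies further right
        because all other agents may be counted.\<close>
      define t where "t = max (u 1) ((1 + real (card others) - b) / coeff_a n \<sigma> \<tau>)"
      have "1 + real (card others) - b \<le> coeff_a n \<sigma> \<tau> * t"
        using a by (auto simp: t_def field_simps max_def)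
      then have "0 \<le> F (u(1 := t))"
        using F_bounds(1)[OF b_def, of t] by linarith
      moreover have "u 1 \<le> t" by (simp add: t_def)
      ultimately obtain r where r: "u 1 \<le> r" "F (u(1 := r)) = 0"
        using IVT'[of "\<lambda>t. F (u(1 := t))" "u 1" 0 t] F cont by auto
      then have "u 1 < r" using F by (cases "r = u 1") auto
      moreover have "h (u(1 := r)) = 0"
        using root[OF mem[OF u]] r by simp
      ultimately show ?thesis
        using dec[OF u, of "u 1" r] by simp
    qed
    show ?thesis
      unfolding best_response_def Let_def others_def[symmetric] expect integral_posterior_Theta
    proof (intro conjI ballI impI strategy)
      fix u
      assume u: "u \<in> Rn n"
      show "?s u = 0" if "1 + (\<Sum>k\<in>others. P u k) < theta_mean u"
        using neg[OF u] that by (simp add: F_def)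
      show "?s u = 1" if "1 + (\<Sum>k\<in>others. P u k) > theta_mean u"
        using pos[OF u] that by (simp add: F_def)
    qed
  qed
  then show ?thesis
    unfolding bayes_nash_equilibrium_def using strategy by simp
qed

end
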